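(* Let $p\geq 5$ be a prime, let $r\geq 1$ be an integer, and let $k=p^r$. Then the following two statements hold. \begin{enumerate} \item For all integers $n\geq 0$, $i\in\{1,2,\ldots,p-1\}$ and $\alpha$ with $1\leq \alpha\leq r/2$, \[ \mathfrak{B}_k\!\left(p^{2\alpha}n+\frac{(12i+p)p^{2\alpha-1}-1}{12}\right) \equiv 0 \pmod p . \] \item Let $j$ be an integer between $1$ and $p-1$ such that $12j+1$ is a quadratic nonresidue modulo $p$. Then for all integers $n\geq 0$ and $\alpha$ with $1\leq \alpha\leq (r-1)/2$, \[ \mathfrak{B}_k\!\left(p^{2\alpha+1}n+\frac{(12j+1)p^{2\alpha}-1}{12}\right)\equiv 0\pmod p . \] \end{enumerate}
   Context: For $|q|<1$ write $(a;q)_\infty=\prod_{j=0}^{\infty}(1-aq^j)$. For an integer $k\geq 3$, $\mathfrak{B}_k(n)$ denotes the number of $k$ dots bracelet partitions of $n$; these integers are determined by the generating function \[ \sum_{n=0}^{\infty}\mathfrak{B}_{k}(n)q^n=\frac{(-q;q)_{\infty}}{(q;q)_{\infty}^{k-1}(-q^k;q^k)_{\infty}} . \] *)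

theory Defs
  imports "HOL-Analysis.Infinite_Products" "HOL-Computational_Algebra.Formal_Power_Series"
    "HOL-Number_Theory.Number_Theory"
begin

definition qpoch_inf :: "'a::{comm_ring_1,t2_space} \<Rightarrow> 'a \<Rightarrow> 'a" where
  "qpoch_inf a q = (\<Prod>j. 1 - a * q ^ j)"

(* The generating function is read as a formal power series in q = fps_X, the infinite products
   being limits in the fps topology.  It is formed over the integers, so that its coefficients are
   integers by construction; over int there is no division of power series, hence the
   multiplication by the inverse of the denominator, whose constant coefficient is 1. *)
definition bracelet_gf :: "nat \<Rightarrow> int fps" where
  "bracelet_gf k =
     qpoch_inf (- fps_X) fps_X *
     fps_left_inverse (qpoch_inf fps_X fps_X ^ (k - 1) * qpoch_inf (- (fps_X ^ k)) (fps_X ^ k)) 1"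

definition bracelet :: "nat \<Rightarrow> nat \<Rightarrow> int" where
  "bracelet k n = fps_nth (bracelet_gf k) n"

text \<open>The products above do converge and the denominator is invertible, so
  \<^const>\<open>bracelet_gf\<close> is the genuine quotient of power series.\<close>

lemma qpoch_inf_fps:
  fixes a q :: "int fps"
  assumes a: "fps_nth a 0 = 0" and q: "fps_nth q 0 = 0"
  shows "(\<lambda>j. 1 - a * q ^ j) has_prod qpoch_inf a q" "fps_nth (qpoch_inf a q) 0 = 1"
proof -
  define P where "P = (\<lambda>n. \<Prod>j\<le>n. 1 - a * q ^ j)"
  have stepS: "fps_nth (P (Suc m)) i = fps_nth (P m) i" if "i \<le> m" for i m
  proof -
    have "fps_nth (P m * (a * q ^ Suc m)) i = 0"
    proof (cases "P m * (a * q ^ Suc m) = 0")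
      case False
      then have nz: "q \<noteq> 0" "a \<noteq> 0" "P m \<noteq> 0" by auto
      have "subdegree q \<ge> 1"
        using q nz(1) by (metis One_nat_def Suc_leI neq0_conv nth_subdegree_nonzero)
      then have "Suc m \<le> subdegree (q ^ Suc m)"
        by (metis mult.right_neutral mult_le_mono2 subdegree_power)
      also have "\<dots> \<le> subdegree (P m * (a * q ^ Suc m))"
        using nz by simp
      finally show ?thesis using that by (intro nth_less_subdegree_zero) simp
    next
      case True
      then show ?thesis by (simp only: fps_zero_nth)
    qed
    then show ?thesis by (simp add: P_def algebra_simps)
  qed
  have stable: "fps_nth (P n) i = fps_nth (P i) i" if "i \<le> n" for i n
    using that by (induction n rule: dec_induct) (auto simp: stepS)
  define L where "L = Abs_fps (\<lambda>i. fps_nth (P i) i)"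
  have lim: "P \<longlonglongrightarrow> L"
  proof (rule tendsto_fpsI)
    fix n show "eventually (\<lambda>m. fps_nth (P m) n = fps_nth L n) sequentially"
      using eventually_ge_at_top[of n] unfolding L_def fps_nth_Abs_fps by eventually_elim (rule stable)
  qed
  have L0: "fps_nth L 0 = 1" by (simp add: L_def P_def a)
  then have "L \<noteq> 0" by auto
  with lim have "(\<lambda>j. 1 - a * q ^ j) has_prod L"
    by (simp add: has_prod_def raw_has_prod_def P_def)
  moreover from this have "qpoch_inf a q = L"
    unfolding qpoch_inf_def by (rule has_prod_unique[symmetric])
  ultimately show "(\<lambda>j. 1 - a * q ^ j) has_prod qpoch_inf a q" "fps_nth (qpoch_inf a q) 0 = 1"
    using L0 by simp_all
qed

lemma bracelet_gf_times_denominator: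
  assumes "k \<ge> 1"
  shows "bracelet_gf k * (qpoch_inf fps_X fps_X ^ (k - 1) * qpoch_inf (- (fps_X ^ k)) (fps_X ^ k))
           = qpoch_inf (- fps_X) fps_X"
proof -
  let ?D = "qpoch_inf fps_X fps_X ^ (k - 1) * qpoch_inf (- (fps_X ^ k)) (fps_X ^ k) :: int fps"
  have "fps_nth ?D 0 = 1"
    using assms by (simp add: fps_power_zeroth qpoch_inf_fps(2))
  then have "fps_left_inverse ?D 1 * ?D = 1"
    by (intro fps_left_inverse) simp
  then show ?thesis by (simp add: bracelet_gf_def mult.assoc)
qed

text \<open>The divisions by 12 in the arguments of the congruences are exact.\<close>

lemma prime_square_cong_1_mod_12:
  fixes p :: nat
  assumes "prime p" "p \<ge> 5"
  shows "[p ^ 2 = 1] (mod 12)"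
proof -
  have "\<not> 2 dvd p" "\<not> 3 dvd p"
    using assms primes_dvd_imp_eq[of 2 p] primes_dvd_imp_eq[of 3 p] by auto
  then have "p mod 12 mod 2 \<noteq> 0" "p mod 12 mod 3 \<noteq> 0"
    by (simp_all add: mod_mod_cancel flip: dvd_eq_mod_eq_0)
  moreover have "p mod 12 \<in> set [0..<12]" by simp
  ultimately have "p mod 12 \<in> {1, 5, 7, 11}" by (auto simp: upt_rec)
  moreover have "p ^ 2 mod 12 = (p mod 12) ^ 2 mod 12" by (simp add: power_mod)
  ultimately show ?thesis by (auto simp: cong_def)
qed

lemma twelve_dvd_arguments:
  fixes p :: nat
  assumes "prime p" "p \<ge> 5" "\<alpha> \<ge> 1"
  shows "12 dvd (12 * i + p) * p ^ (2 * \<alpha> - 1) - 1" "12 dvd (12 * j + 1) * p ^ (2 * \<alpha>) - 1"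
proof -
  have c: "p ^ (2 * \<alpha>) mod 12 = 1"
    using cong_pow[OF prime_square_cong_1_mod_12[OF assms(1,2)], of \<alpha>]
    by (simp add: power_mult cong_def)
  have "p * p ^ (2 * \<alpha> - 1) = p ^ (2 * \<alpha>)"
    using assms(3) by (simp flip: power_Suc)
  then have "(12 * i + p) * p ^ (2 * \<alpha> - 1) = p ^ (2 * \<alpha>) + (i * p ^ (2 * \<alpha> - 1)) * 12"
    "(12 * j + 1) * p ^ (2 * \<alpha>) = p ^ (2 * \<alpha>) + (j * p ^ (2 * \<alpha>)) * 12"
    by (simp_all add: add_mult_distrib)
  then have "((12 * i + p) * p ^ (2 * \<alpha> - 1)) mod 12 = 1" "((12 * j + 1) * p ^ (2 * \<alpha>)) mod 12 = 1"
    using c by (simp_all only: mod_mult_self1)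
  then have "[(12 * i + p) * p ^ (2 * \<alpha> - 1) = 1] (mod 12)" "[(12 * j + 1) * p ^ (2 * \<alpha>) = 1] (mod 12)"
    unfolding cong_def by simp_all
  then show "12 dvd (12 * i + p) * p ^ (2 * \<alpha> - 1) - 1" "12 dvd (12 * j + 1) * p ^ (2 * \<alpha>) - 1"
    using cong_to_1_nat by blast+
qed

end

theory Submission
  imports Defs
begin

text \<open>
  Write \<open>(a; q)\<close> for the infinite product, so that the generating function is
  \<open>(-X; X) / ((X; X)\<^sup>k\<^sup>-\<^sup>1 (-X\<^sup>k; X\<^sup>k))\<close>. Multiplying numerator and denominator by \<open>(X; X)\<close> turns the
  numerator into \<open>(X\<^sup>2; X\<^sup>2)\<close> and the first factor of the denominator into \<open>(X; X)\<^sup>k\<close>. Since \<open>k\<close> is a power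
  of \<open>p\<close>, Frobenius applied to each factor replaces the latter by \<open>(X\<^sup>k; X\<^sup>k)\<close> modulo \<open>p\<close>
  (\<open>bracelet_prime_power_cong\<close>). After this the denominator is a power series in \<open>X\<^sup>k\<close> with constant
  term 1, so division by it mixes only coefficients whose indices agree modulo \<open>k\<close>
  (\<open>fps_residue_class_dvd\<close>).

  By Euler's pentagonal number theorem the coefficient of \<open>X\<^sup>n\<close> in \<open>(X\<^sup>2; X\<^sup>2)\<close> vanishes unless
  \<open>12 n + 1\<close> is a perfect square. Hence \<open>p\<close> divides the \<open>N\<close>-th bracelet number as soon as \<open>12 N + 1\<close> is
  not a square modulo \<open>k\<close> (\<open>bracelet_prime_power_dvd\<close>). For the indices of the first family,
  \<open>12 N + 1\<close> is exactly divisible by the odd power \<open>p\<^sup>2\<^sup>\<alpha>\<^sup>-\<^sup>1\<close>; for those of the second family it is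
  \<open>p\<^sup>2\<^sup>\<alpha>\<close> times a quadratic nonresidue. The bounds on \<open>\<alpha>\<close> say that \<open>k\<close> is divisible by
  one further factor \<open>p\<close>, so either property can be seen modulo \<open>k\<close> and rules out squares.

  The pentagonal number theorem comes from a finite identity of Shanks, which telescopes.
\<close>

section \<open>Euler's pentagonal number theorem\<close>

lemma qpoch_inf_tendsto:
  fixes a q :: "int fps"
  assumes "fps_nth a 0 = 0" "fps_nth q 0 = 0"
  shows "(\<lambda>n. \<Prod>j<n. 1 - a * q ^ j) \<longlonglongrightarrow> qpoch_inf a q"
  using assms by (intro has_prod_imp_tendsto' qpoch_inf_fps)

text \<open>
  With \<open>(q)\<^sub>n = (1 - q) \<dots> (1 - q\<^sup>n)\<close>, the left-hand side is
  \<open>\<Sum>s\<le>n. (-1)\<^sup>s (q)\<^sub>n / (q)\<^sub>s q\<^bsup>sn + s(s+1)/2\<^esup>\<close>; the quotient is written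
  without division so that the identity holds in every commutative ring. The exponents on the right
  are the generalised pentagonal numbers \<open>s(3s - 1)/2\<close> and \<open>s(3s + 1)/2\<close>, with binomial
  coefficients in place of the halves. When \<open>n\<close> grows by one, the change of the \<open>s\<close>-th summand on the left
  is a difference of consecutive terms of a sequence, so only two monomials survive, and these are
  the new pentagonal ones.
\<close>

lemma shanks_identity:
  fixes q :: "'a :: comm_ring_1"
  shows "(\<Sum>s\<le>n. (-1) ^ s * (\<Prod>j\<in>{s<..n}. 1 - q ^ j) * q ^ (s * n + (Suc s choose 2))) =
         1 + (\<Sum>s=1..n. (-1) ^ s * (q ^ (s\<^sup>2 + (s choose 2)) + q ^ (s\<^sup>2 + (Suc s choose 2))))"
proof (induction n)
  case 0
  show ?case by (simp add: numeral_2_eq_2)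
next
  case (Suc n)
  \<comment> \<open>\<open>T n s\<close> is the \<open>s\<close>-th summand. Splitting the factor \<open>1 - q ^ Suc n\<close> of \<open>T (Suc n) s\<close> produces
    a term close to \<open>T n s\<close> and the term \<open>- G s\<close>; the discrepancy between the former and \<open>T n s\<close>
    has a factor \<open>1 - q ^ s\<close>, which lengthens the product and gives \<open>G (s - 1)\<close>. \<open>H\<close> is \<open>G\<close> shifted by one.\<close>
  define T where "T = (\<lambda>n s. (-1) ^ s * (\<Prod>j\<in>{s<..n}. 1 - q ^ j) * q ^ (s * n + (Suc s choose 2)))"
  define G where "G = (\<lambda>s. (-1) ^ s * (\<Prod>j\<in>{s<..n}. 1 - q ^ j) * q ^ (Suc s * Suc n + (Suc s choose 2)))"
  define H where "H = (\<lambda>s. case s of 0 \<Rightarrow> 0 | Suc t \<Rightarrow> G t)"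
  have choose_Suc: "(Suc s choose 2) = s + (s choose 2)" for s
    by (simp add: numeral_2_eq_2)
  have step: "T (Suc n) s = T n s + (H s - H (Suc s))" if "s \<le> n" for s
  proof -
    have "{s<..Suc n} = insert (Suc n) {s<..n}" using that by auto
    then have top: "(\<Prod>j\<in>{s<..Suc n}. 1 - q ^ j) = (1 - q ^ Suc n) * (\<Prod>j\<in>{s<..n}. 1 - q ^ j)"
      by simp
    show ?thesis
    proof (cases s)
      case 0
      show ?thesis unfolding T_def H_def G_def top by (simp add: 0 numeral_2_eq_2 algebra_simps)
    next
      case (Suc t)
      have "{t<..n} = insert (Suc t) {Suc t<..n}" using that Suc by auto
      then have bot: "(\<Prod>j\<in>{t<..n}. 1 - q ^ j) = (1 - q ^ s) * (\<Prod>j\<in>{s<..n}. 1 - q ^ j)"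
        by (simp add: Suc)
      have "H s = - ((-1) ^ s * (\<Prod>j\<in>{s<..n}. 1 - q ^ j) * (1 - q ^ s) * q ^ (s * Suc n + (s choose 2)))"
        unfolding H_def G_def by (simp add: Suc bot[unfolded Suc] mult_ac)
      then show ?thesis unfolding T_def top
        by (simp add: H_def G_def choose_Suc power_add algebra_simps)
    qed
  qed
  have "(\<Sum>s\<le>Suc n. T (Suc n) s) = (\<Sum>s\<le>n. T n s) + (\<Sum>s\<le>n. H s - H (Suc s)) + T (Suc n) (Suc n)"
    by (simp add: step sum.distrib)
  also have "(\<Sum>s\<le>n. H s - H (Suc s)) = - G n"
    by (subst sum_telescope) (simp add: H_def)
  also have "- G n = (-1) ^ Suc n * q ^ ((Suc n)\<^sup>2 + (Suc n choose 2))"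
    by (simp add: G_def power2_eq_square)
  also have "T (Suc n) (Suc n) = (-1) ^ Suc n * q ^ ((Suc n)\<^sup>2 + (Suc (Suc n) choose 2))"
    by (simp add: T_def power2_eq_square)
  finally show ?case using Suc.IH by (simp add: T_def algebra_simps)
qed

text \<open>
  In Shanks' identity the summand \<open>s = 0\<close> is the truncated product, and every other summand is
  divisible by \<open>q ^ n\<close>. So both sides have the same coefficients below \<open>n\<close>.
\<close>

lemma pentagonal_number_theorem_fps:
  fixes q :: "int fps"
  assumes q: "fps_nth q 0 = 0"
  shows "(\<lambda>n. 1 + (\<Sum>s=1..n. (-1) ^ s * (q ^ (s\<^sup>2 + (s choose 2)) + q ^ (s\<^sup>2 + (Suc s choose 2)))))
           \<longlonglongrightarrow> qpoch_inf q q"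
    (is "?S \<longlonglongrightarrow> _")
proof (rule tendsto_fpsI)
  fix i
  have low: "fps_nth (f * q ^ m) i = 0" if "m > i" for f m
  proof -
    have "q = fps_X * fps_shift 1 q" 
      using q by (intro fps_ext) (simp add: fps_X_mult_nth)
    then have "q ^ m = fps_X ^ m * fps_shift 1 q ^ m" by (metis power_mult_distrib)
    then have "f * q ^ m = fps_X ^ m * (f * fps_shift 1 q ^ m)" by simp
    then show ?thesis using that by (simp only: fps_X_power_mult_nth if_True)
  qed
  have "(\<lambda>n. \<Prod>j<n. 1 - q * q ^ j) \<longlonglongrightarrow> qpoch_inf q q"
    using q by (rule qpoch_inf_tendsto[OF _ q])
  then have "\<forall>\<^sub>F n in sequentially. fps_nth (\<Prod>j<n. 1 - q * q ^ j) i = fps_nth (qpoch_inf q q) i"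
    by (simp add: tendsto_fps_iff)
  then show "\<forall>\<^sub>F n in sequentially. fps_nth (?S n) i = fps_nth (qpoch_inf q q) i"
    using eventually_gt_at_top[of i]
  proof eventually_elim
    case (elim n)
    let ?t = "\<lambda>s. (-1) ^ s * (\<Prod>j\<in>{s<..n}. 1 - q ^ j) * q ^ (s * n + (Suc s choose 2))"
    have "?S n = (\<Sum>s\<le>n. ?t s)" by (rule shanks_identity [symmetric])
    also have "\<dots> = ?t 0 + (\<Sum>s=1..n. ?t s)"
      by (simp add: sum.atLeast1_atMost_eq sum.atMost_shift del: binomial_Suc_Suc)
    also have "?t 0 = (\<Prod>j<n. 1 - q * q ^ j)"
      by (simp add: numeral_2_eq_2 prod.atLeast1_atMost_eq
          flip: atLeastSucAtMost_greaterThanAtMost power_Suc)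
    finally have "fps_nth (?S n) i = fps_nth (\<Prod>j<n. 1 - q * q ^ j) i + (\<Sum>s=1..n. fps_nth (?t s) i)"
      by (simp add: fps_sum_nth)
    also have "(\<Sum>s=1..n. fps_nth (?t s) i) = 0"
    proof (intro sum.neutral ballI low)
      fix s assume "s \<in> {1..n}"
      then have "n \<le> s * n" by simp
      then show "i < s * n + (Suc s choose 2)" using elim(2) by linarith
    qed
    finally show ?case using elim(1) by simp
  qed
qed

text \<open>
  The exponents occurring in \<open>(X\<^sup>2; X\<^sup>2)\<close> are \<open>n = s(3s \<plusminus> 1)\<close>, and then
  \<open>12 n + 1 = (6 s \<plusminus> 1)\<^sup>2\<close>.
\<close>

lemma qpoch_X2_nonzero_imp_square:
  assumes "fps_nth (qpoch_inf (fps_X\<^sup>2) (fps_X\<^sup>2) :: int fps) n \<noteq> 0"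
  shows "\<exists>z. 12 * n + 1 = z\<^sup>2"
proof (cases "n = 0")
  case True
  then show ?thesis by (intro exI[of _ 1]) simp
next
  case False
  define U :: "nat \<Rightarrow> int fps" where "U = (\<lambda>s. (-1) ^ s *
    ((fps_X\<^sup>2) ^ (s\<^sup>2 + (s choose 2)) + (fps_X\<^sup>2) ^ (s\<^sup>2 + (Suc s choose 2))))"
  have "(\<lambda>m. 1 + (\<Sum>s=1..m. U s)) \<longlonglongrightarrow> qpoch_inf (fps_X\<^sup>2) (fps_X\<^sup>2)"
    unfolding U_def by (rule pentagonal_number_theorem_fps) simp
  then have "\<forall>\<^sub>F m in sequentially.
      fps_nth (1 + (\<Sum>s=1..m. U s)) n = fps_nth (qpoch_inf (fps_X\<^sup>2) (fps_X\<^sup>2)) n"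
    unfolding tendsto_fps_iff by blast
  then obtain m where "fps_nth (1 + (\<Sum>s=1..m. U s)) n = fps_nth (qpoch_inf (fps_X\<^sup>2) (fps_X\<^sup>2)) n"
    by (auto simp only: eventually_sequentially)
  then have "(\<Sum>s=1..m. fps_nth (U s) n) \<noteq> 0"
    using assms False by (simp add: fps_sum_nth)
  then obtain s where s: "s \<in> {1..m}" "fps_nth (U s) n \<noteq> 0"
    by (rule sum.not_neutral_contains_not_neutral)
  have "fps_nth ((-1) ^ s * f) n = (-1) ^ s * fps_nth f n" for f :: "int fps"
    by (cases "even s") simp_all
  then have "fps_nth (U s) n = (-1) ^ s * (fps_nth (fps_X ^ (2 * (s\<^sup>2 + (s choose 2)))) n +
      fps_nth (fps_X ^ (2 * (s\<^sup>2 + (Suc s choose 2)))) n)"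
    by (simp only: U_def power_mult fps_add_nth)
  then have n: "n = 2 * (s\<^sup>2 + (s choose 2)) \<or> n = 2 * (s\<^sup>2 + (Suc s choose 2))"
    using s(2) unfolding fps_X_power_nth by presburger
  have c: "2 * (Suc s choose 2) = s * Suc s" for s
    by (induction s) (simp_all add: numeral_2_eq_2)
  \<comment> \<open>With \<open>s = t + 1\<close> the root \<open>6 s - 1\<close> becomes \<open>6 t + 5\<close>, which avoids truncated subtraction.\<close>
  obtain t where t: "s = Suc t" using s(1) by (cases s) auto
  have "n = 2 * s\<^sup>2 + t * s \<or> n = 2 * s\<^sup>2 + s * Suc s"
    using n c[of t] c[of s] unfolding t distrib_left by presburger
  then have "12 * n + 1 = (6 * t + 5)\<^sup>2 \<or> 12 * n + 1 = (6 * s + 1)\<^sup>2"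
    by (auto simp: t power2_eq_square algebra_simps)
  then show ?thesis by blast
qed

section \<open>Power series modulo a prime\<close>

lemma of_nat_dvd_fps_iff: "of_nat p dvd (f :: int fps) \<longleftrightarrow> (\<forall>n. int p dvd fps_nth f n)"
proof
  assume "of_nat p dvd f"
  then obtain g where "f = of_nat p * g" by blast
  then show "\<forall>n. int p dvd fps_nth f n" by (simp flip: fps_of_nat)
next
  assume "\<forall>n. int p dvd fps_nth f n"
  then have "f = of_nat p * Abs_fps (\<lambda>n. fps_nth f n div int p)"
    by (intro fps_ext) (simp flip: fps_of_nat)
  then show "of_nat p dvd f" by (rule dvdI)
qed

lemma dvd_diff_mult:
  fixes c :: "'a :: comm_ring_1"
  assumes "c dvd a - a'" "c dvd b - b'"
  shows "c dvd a * b - a' * b'"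
proof -
  have "a * b - a' * b' = (a - a') * b + a' * (b - b')" by (simp add: algebra_simps)
  then show ?thesis using assms by simp
qed

lemma dvd_diff_power:
  fixes c :: "'a :: comm_ring_1"
  assumes "c dvd a - b"
  shows "c dvd a ^ n - b ^ n"
  using assms by (induction n) (simp_all add: dvd_diff_mult)

lemma dvd_diff_prod:
  fixes c :: "'a :: comm_ring_1"
  assumes "\<And>i. i \<in> A \<Longrightarrow> c dvd f i - g i"
  shows "c dvd prod f A - prod g A"
  using assms by (induction A rule: infinite_finite_induct) (simp_all add: dvd_diff_mult)

text \<open>
  The Frobenius congruence, in a form that applies in characteristic 0: it is used for integer power
  series, in which \<open>p\<close> is not zero. The middle binomial coefficients are divisible by \<open>p\<close>.
\<close>

lemma prime_dvd_one_minus_power: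
  fixes x :: "'a :: comm_ring_1"
  assumes p: "prime p" "odd p"
  shows "of_nat p dvd (1 - x) ^ p - (1 - x ^ p)"
proof -
  have p0: "p > 0" using p(1) by (rule prime_gt_0_nat)
  have "(1 - x) ^ p = (- x + 1) ^ p" by simp
  also have "\<dots> = (\<Sum>i\<le>p. of_nat (p choose i) * (- x) ^ i)"
    by (subst binomial_ring) simp
  also have "{..p} = insert 0 (insert p {1..<p})" using p0 by auto
  also have "(\<Sum>i\<in>\<dots>. of_nat (p choose i) * (- x) ^ i) =
      1 - x ^ p + (\<Sum>i=1..<p. of_nat (p choose i) * (- x) ^ i)"
    using p0 p(2) by simp
  finally have "(1 - x) ^ p - (1 - x ^ p) = (\<Sum>i=1..<p. of_nat (p choose i) * (- x) ^ i)" by simp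
  moreover have "of_nat p dvd (of_nat (p choose i) :: 'a)" if "i \<in> {1..<p}" for i
    using dvd_choose_prime[of i p] that p(1) p0 by (auto elim!: dvdE)
  ultimately show ?thesis by (simp only:) (intro dvd_sum dvd_mult2)
qed

lemma prime_dvd_one_minus_prime_power:
  fixes x :: "'a :: comm_ring_1"
  assumes p: "prime p" "odd p"
  shows "of_nat p dvd (1 - x) ^ (p ^ r) - (1 - x ^ (p ^ r))"
proof (induction r)
  case (Suc r)
  have "of_nat p dvd ((1 - x) ^ (p ^ r)) ^ p - (1 - x ^ (p ^ r)) ^ p"
    using Suc.IH by (rule dvd_diff_power)
  moreover have "of_nat p dvd (1 - x ^ (p ^ r)) ^ p - (1 - (x ^ (p ^ r)) ^ p)"
    using p by (rule prime_dvd_one_minus_power)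
  ultimately have "of_nat p dvd ((1 - x) ^ (p ^ r)) ^ p - (1 - (x ^ (p ^ r)) ^ p)"
    by (metis (no_types) dvd_add diff_add_cancel add_diff_eq)
  then show ?case by (simp add: mult.commute flip: power_mult)
qed simp

lemma tendsto_mult_fps:
  fixes f g :: "'b \<Rightarrow> 'a :: ring fps"
  assumes "(f \<longlongrightarrow> a) F" "(g \<longlongrightarrow> b) F"
  shows "((\<lambda>x. f x * g x) \<longlongrightarrow> a * b) F"
proof (rule tendsto_fpsI)
  fix n
  have "\<forall>\<^sub>F x in F. \<forall>i\<in>{..n}. fps_nth (f x) i = fps_nth a i"
    "\<forall>\<^sub>F x in F. \<forall>i\<in>{..n}. fps_nth (g x) i = fps_nth b i"
    using assms by (simp_all add: tendsto_fps_iff eventually_ball_finite_distrib)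
  then show "\<forall>\<^sub>F x in F. fps_nth (f x * g x) n = fps_nth (a * b) n"
    by eventually_elim (simp add: fps_mult_nth)
qed

lemma tendsto_power_fps:
  fixes f :: "'b \<Rightarrow> 'a :: ring_1 fps"
  assumes "(f \<longlongrightarrow> a) F"
  shows "((\<lambda>x. f x ^ n) \<longlongrightarrow> a ^ n) F"
  using assms by (induction n) (simp_all add: tendsto_mult_fps)

lemma of_nat_dvd_diff_limit_fps:
  fixes f g :: "nat \<Rightarrow> int fps"
  assumes "f \<longlonglongrightarrow> a" "g \<longlonglongrightarrow> b" "\<And>n. of_nat p dvd f n - g n"
  shows "of_nat p dvd a - b"
  unfolding of_nat_dvd_fps_iff
proof
  fix i
  have "\<forall>\<^sub>F n in sequentially. fps_nth (f n) i = fps_nth a i"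
    "\<forall>\<^sub>F n in sequentially. fps_nth (g n) i = fps_nth b i"
    using assms(1,2) by (simp_all add: tendsto_fps_iff)
  then have "\<forall>\<^sub>F n in sequentially. int p dvd fps_nth (a - b) i"
  proof eventually_elim
    case (elim n)
    then show ?case using assms(3)[of n] by (metis of_nat_dvd_fps_iff fps_sub_nth)
  qed
  then show "int p dvd fps_nth (a - b) i" by simp
qed

lemma fps_mult_nth_nonzero_dvd:
  fixes f g :: "'a :: semiring_1 fps"
  assumes "\<And>n. fps_nth f n \<noteq> 0 \<Longrightarrow> k dvd n" "\<And>n. fps_nth g n \<noteq> 0 \<Longrightarrow> k dvd n"
    "fps_nth (f * g) n \<noteq> 0"
  shows "k dvd n"
proof -
  from assms(3) obtain i where i: "i \<le> n" "fps_nth f i * fps_nth g (n - i) \<noteq> 0"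
    by (auto simp: fps_mult_nth elim: sum.not_neutral_contains_not_neutral)
  then have "fps_nth f i \<noteq> 0" "fps_nth g (n - i) \<noteq> 0" by auto
  then show ?thesis using assms(1,2) i(1) by (metis dvd_add le_add_diff_inverse)
qed

text \<open>
  Division by \<open>D\<close>: since \<open>D\<close> has constant term 1 and involves only exponents divisible by \<open>k\<close>, the
  recursion for the \<open>n\<close>-th coefficient of \<open>f\<close> refers only to earlier coefficients of \<open>f\<close> in the
  same residue class modulo \<open>k\<close>. Vanishing of \<open>g\<close> modulo \<open>p\<close> on a residue class therefore passes to \<open>f\<close>.
\<close>

lemma fps_residue_class_dvd:
  fixes f D g :: "int fps"
  assumes D0: "fps_nth D 0 = 1" and D: "\<And>n. fps_nth D n \<noteq> 0 \<Longrightarrow> k dvd n"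
    and fD: "of_nat p dvd f * D - g"
    and g: "\<And>n. [n = N] (mod k) \<Longrightarrow> int p dvd fps_nth g n"
  shows "int p dvd fps_nth f N"
proof -
  have "int p dvd fps_nth f n" if "[n = N] (mod k)" for n
    using that
  proof (induction n rule: less_induct)
    case (less n)
    have "fps_nth (f * D) n = fps_nth f n + (\<Sum>i<n. fps_nth f i * fps_nth D (n - i))"
      by (simp add: fps_mult_nth D0 atLeast0AtMost flip: lessThan_Suc_atMost)
    moreover have "int p dvd (\<Sum>i<n. fps_nth f i * fps_nth D (n - i))"
    proof (rule dvd_sum)
      fix i assume i: "i \<in> {..<n}"
      show "int p dvd fps_nth f i * fps_nth D (n - i)"
      proof (cases "fps_nth D (n - i) = 0")
        case False
        then obtain c where "n - i = k * c" using D by blast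
        then have "n = i + k * c" using i by simp
        then have "[i = n] (mod k)" by (simp add: cong_def)
        then show ?thesis using less.IH[of i] cong_trans[OF _ less.prems] i by simp
      qed simp
    qed
    moreover have "int p dvd fps_nth (f * D) n"
      using fD g[OF less.prems] by (metis of_nat_dvd_fps_iff dvd_diff_right_iff fps_sub_nth dvd_diff_commute dvd_diff_left_iff)
    ultimately show ?case by (simp add: dvd_add_left_iff)
  qed
  then show ?thesis by simp
qed

section \<open>The generating function modulo a prime\<close>

lemma qpoch_inf_mult_minus:
  fixes a q :: "int fps"
  assumes "fps_nth a 0 = 0" "fps_nth q 0 = 0"
  shows "qpoch_inf (- a) q * qpoch_inf a q = qpoch_inf (a\<^sup>2) (q\<^sup>2)"
proof (rule LIMSEQ_unique)
  show "(\<lambda>n. (\<Prod>j<n. 1 - (- a) * q ^ j) * (\<Prod>j<n. 1 - a * q ^ j)) 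
      \<longlonglongrightarrow> qpoch_inf (- a) q * qpoch_inf a q"
    using assms by (intro tendsto_mult_fps qpoch_inf_tendsto) simp_all
  have "(1 - (- a) * q ^ j) * (1 - a * q ^ j) = 1 - a\<^sup>2 * (q\<^sup>2) ^ j" for j
    by (simp add: algebra_simps power2_eq_square power_mult_distrib)
  then have "(\<lambda>n. (\<Prod>j<n. 1 - (- a) * q ^ j) * (\<Prod>j<n. 1 - a * q ^ j)) =
      (\<lambda>n. \<Prod>j<n. 1 - a\<^sup>2 * (q\<^sup>2) ^ j)"
    by (simp flip: prod.distrib)
  then show "(\<lambda>n. (\<Prod>j<n. 1 - (- a) * q ^ j) * (\<Prod>j<n. 1 - a * q ^ j)) 
      \<longlonglongrightarrow> qpoch_inf (a\<^sup>2) (q\<^sup>2)"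
    using assms by (simp only:) (intro qpoch_inf_tendsto, simp_all add: power2_eq_square)
qed

text \<open>
  Frobenius holds for each factor, hence for the truncated products, and a congruence between
  convergent sequences of power series passes to the limit because each coefficient is eventually
  constant.
\<close>

lemma qpoch_inf_prime_power:
  fixes a q :: "int fps"
  assumes "fps_nth a 0 = 0" "fps_nth q 0 = 0" and p: "prime p" "odd p"
  shows "of_nat p dvd qpoch_inf a q ^ (p ^ r) - qpoch_inf (a ^ (p ^ r)) (q ^ (p ^ r))"
proof (rule of_nat_dvd_diff_limit_fps)
  have k: "p ^ r > 0" using p(1) by (simp add: prime_gt_0_nat)
  show "(\<lambda>n. (\<Prod>j<n. 1 - a * q ^ j) ^ (p ^ r)) \<longlonglongrightarrow> qpoch_inf a q ^ (p ^ r)"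
    using assms by (intro tendsto_power_fps qpoch_inf_tendsto)
  show "(\<lambda>n. \<Prod>j<n. 1 - a ^ (p ^ r) * (q ^ (p ^ r)) ^ j) \<longlonglongrightarrow> qpoch_inf (a ^ (p ^ r)) (q ^ (p ^ r))"
    using assms k by (intro qpoch_inf_tendsto) (simp_all add: fps_power_zeroth)
  fix n
  show "of_nat p dvd (\<Prod>j<n. 1 - a * q ^ j) ^ (p ^ r) - (\<Prod>j<n. 1 - a ^ (p ^ r) * (q ^ (p ^ r)) ^ j)"
    unfolding prod_power_distrib
  proof (rule dvd_diff_prod)
    fix j
    show "of_nat p dvd (1 - a * q ^ j) ^ (p ^ r) - (1 - a ^ (p ^ r) * (q ^ (p ^ r)) ^ j)"
      using prime_dvd_one_minus_prime_power[OF p, of "a * q ^ j" r]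
      by (simp add: power_mult_distrib mult.commute flip: power_mult)
  qed
qed

lemma qpoch_inf_X_power_nth_nonzero_dvd:
  fixes a :: "int fps"
  assumes a: "a \<in> {fps_X ^ k, - (fps_X ^ k)}" and k: "k > 0"
    and nz: "fps_nth (qpoch_inf a (fps_X ^ k)) n \<noteq> 0"
  shows "k dvd n"
proof -
  have "(\<lambda>n. \<Prod>j<n. 1 - a * (fps_X ^ k) ^ j) \<longlonglongrightarrow> qpoch_inf a (fps_X ^ k)"
    using a k by (intro qpoch_inf_tendsto) (auto simp: fps_power_zeroth)
  then have "\<forall>\<^sub>F m in sequentially. fps_nth (\<Prod>j<m. 1 - a * (fps_X ^ k) ^ j) n = fps_nth (qpoch_inf a (fps_X ^ k)) n"
    unfolding tendsto_fps_iff by blast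
  then obtain m where m: "fps_nth (\<Prod>j<m. 1 - a * (fps_X ^ k) ^ j) n = fps_nth (qpoch_inf a (fps_X ^ k)) n"
    by (auto simp only: eventually_sequentially)
  have factor: "k dvd i" if nzi: "fps_nth (1 - a * (fps_X ^ k) ^ j) i \<noteq> 0" for i j
  proof -
    have "fps_X ^ k * (fps_X ^ k) ^ j = (fps_X ^ (k * Suc j) :: int fps)"
      by (simp only: power_mult power_Suc)
    then have "a * (fps_X ^ k) ^ j \<in> {fps_X ^ (k * Suc j), - (fps_X ^ (k * Suc j))}"
      using a by auto
    then have "i = 0 \<or> i = k * Suc j" using nzi by (auto split: if_splits)
    then show ?thesis by auto
  qed
  have "k dvd i" if "fps_nth (\<Prod>j<m. 1 - a * (fps_X ^ k) ^ j) i \<noteq> 0" for i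
    using that
  proof (induction m arbitrary: i)
    case (Suc m)
    show ?case
      by (rule fps_mult_nth_nonzero_dvd[OF Suc.IH factor]) (use Suc.prems in simp_all)
  qed (simp split: if_splits)
  then show ?thesis using m nz by simp
qed

lemma bracelet_prime_power_cong:
  assumes p: "prime p" "odd p" and k: "k = p ^ r"
  shows "of_nat p dvd bracelet_gf k * (qpoch_inf (fps_X ^ k) (fps_X ^ k) * qpoch_inf (- (fps_X ^ k)) (fps_X ^ k))
           - qpoch_inf (fps_X\<^sup>2) (fps_X\<^sup>2)"
proof -
  let ?E = "qpoch_inf fps_X fps_X :: int fps" and ?M = "qpoch_inf (- (fps_X ^ k)) (fps_X ^ k) :: int fps"
  have k0: "k \<ge> 1" using p(1) k by (simp add: prime_gt_0_nat Suc_leI)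
  then have "?E ^ k = ?E ^ (k - 1) * ?E" by (cases k) simp_all
  then have "bracelet_gf k * (?E ^ k * ?M) = bracelet_gf k * (?E ^ (k - 1) * ?M) * ?E"
    by (simp add: mult_ac)
  also have "\<dots> = qpoch_inf (- fps_X) fps_X * ?E"
    by (simp only: bracelet_gf_times_denominator[OF k0])
  also have "\<dots> = qpoch_inf (fps_X\<^sup>2) (fps_X\<^sup>2)"
    by (rule qpoch_inf_mult_minus) simp_all
  finally have eq: "qpoch_inf (fps_X\<^sup>2) (fps_X\<^sup>2) = bracelet_gf k * (?E ^ k * ?M)" ..
  have "of_nat p dvd ?E ^ k - qpoch_inf (fps_X ^ k) (fps_X ^ k)"
    unfolding k by (rule qpoch_inf_prime_power[OF _ _ p]) simp_all
  then have "of_nat p dvd qpoch_inf (fps_X ^ k) (fps_X ^ k) - ?E ^ k"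
    by (subst (asm) dvd_minus_iff [symmetric]) (simp only: minus_diff_eq)
  then show ?thesis
    unfolding eq by (intro dvd_diff_mult) (simp_all only: diff_self dvd_0_right)
qed

text \<open>
  All numbers \<open>n\<close> in the residue class of \<open>N\<close> modulo \<open>k\<close> give the same residue of \<open>12 n + 1\<close>
  modulo \<open>k\<close>. If it is not a square modulo \<open>k\<close>, then \<open>(X\<^sup>2; X\<^sup>2)\<close> has no term in the whole class.
\<close>

lemma bracelet_prime_power_dvd:
  assumes p: "prime p" "odd p" and k: "k = p ^ r"
    and no_square: "\<And>z. \<not> [z\<^sup>2 = 12 * N + 1] (mod k)"
  shows "[bracelet k N = 0] (mod int p)"
proof -
  have k0: "k > 0" using p(1) k by (simp add: prime_gt_0_nat)
  have "int p dvd fps_nth (bracelet_gf k) N"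
  proof (rule fps_residue_class_dvd[OF _ _ bracelet_prime_power_cong[OF p k]])
    show "fps_nth (qpoch_inf (fps_X ^ k) (fps_X ^ k) * qpoch_inf (- (fps_X ^ k)) (fps_X ^ k)) 0 = (1::int)"
      using k0 by (simp add: qpoch_inf_fps(2) fps_power_zeroth)
  next
    fix n assume "fps_nth (qpoch_inf (fps_X ^ k) (fps_X ^ k) * qpoch_inf (- (fps_X ^ k)) (fps_X ^ k)) n \<noteq> (0::int)"
    then show "k dvd n"
      by (rule fps_mult_nth_nonzero_dvd[rotated 2])
         (erule qpoch_inf_X_power_nth_nonzero_dvd[rotated 2]; simp add: k0)+
  next
    fix n assume n: "[n = N] (mod k)"
    then have "[12 * n + 1 = 12 * N + 1] (mod k)" by (intro cong_add cong_mult) simp_all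
    then have "12 * n + 1 \<noteq> z\<^sup>2" for z using no_square[of z] by auto
    then have "fps_nth (qpoch_inf (fps_X\<^sup>2) (fps_X\<^sup>2)) n = (0::int)"
      using qpoch_X2_nonzero_imp_square by blast
    then show "int p dvd fps_nth (qpoch_inf (fps_X\<^sup>2) (fps_X\<^sup>2)) n" by simp
  qed
  then show ?thesis by (simp add: bracelet_def cong_0_iff)
qed

section \<open>Squares modulo prime powers\<close>

text \<open>
  Modulo \<open>p\<^sup>2\<^sup>\<alpha>\<close>, which divides \<open>p\<^sup>r\<close>, one can still see that \<open>p\<close> has multiplicity exactly
  \<open>2 \<alpha> - 1\<close> in the right-hand side. A square has even multiplicity.
\<close>

lemma square_not_cong_odd_valuation:
  fixes p u z :: nat
  assumes p: "prime p" and "\<not> p dvd u" and "1 \<le> \<alpha>" "2 * \<alpha> \<le> r"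
  shows "\<not> [z\<^sup>2 = p ^ (2 * \<alpha> - 1) * u] (mod p ^ r)"
proof
  assume "[z\<^sup>2 = p ^ (2 * \<alpha> - 1) * u] (mod p ^ r)"
  then have c: "[z\<^sup>2 = p ^ (2 * \<alpha> - 1) * u] (mod p ^ (2 * \<alpha>))"
    by (rule cong_dvd_modulus_nat) (use assms in \<open>simp add: le_imp_power_dvd\<close>)
  have pp: "p ^ (2 * \<alpha>) = p ^ (2 * \<alpha> - 1) * p" 
    using \<open>1 \<le> \<alpha>\<close> by (simp flip: power_Suc2)
  have nd: "\<not> p ^ (2 * \<alpha>) dvd z\<^sup>2"
  proof
    assume "p ^ (2 * \<alpha>) dvd z\<^sup>2"
    then have "p ^ (2 * \<alpha> - 1) * p dvd p ^ (2 * \<alpha> - 1) * u"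
      unfolding cong_dvd_iff[OF c] unfolding pp .
    then show False using \<open>\<not> p dvd u\<close> p by (simp add: prime_gt_0_nat)
  qed
  have "[z\<^sup>2 = p ^ (2 * \<alpha> - 1) * u] (mod p ^ (2 * \<alpha> - 1))"
    using c by (rule cong_dvd_modulus_nat) (simp add: pp)
  then have d: "p ^ (2 * \<alpha> - 1) dvd z\<^sup>2" by (simp add: cong_dvd_iff)
  have "z \<noteq> 0" by (rule notI) (use nd in simp)
  then have m: "multiplicity p (z\<^sup>2) = 2 * multiplicity p z"
    using p by (simp add: prime_elem_multiplicity_power_distrib)
  have "p ^ n dvd z\<^sup>2 \<longleftrightarrow> n \<le> multiplicity p (z\<^sup>2)" for n
    using \<open>z \<noteq> 0\<close> p not_prime_unit[of p] by (intro power_dvd_iff_le_multiplicity) auto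
  with d nd have "2 * \<alpha> - 1 \<le> multiplicity p (z\<^sup>2)" "\<not> 2 * \<alpha> \<le> multiplicity p (z\<^sup>2)"
    by blast+
  then show False using m by presburger
qed

text \<open>
  The congruence forces \<open>p\<^sup>\<alpha>\<close> to divide \<open>z\<close>; cancelling \<open>p\<^sup>2\<^sup>\<alpha>\<close> leaves at least one factor \<open>p\<close> in
  the modulus, and \<open>z / p\<^sup>\<alpha>\<close> is a square root of \<open>u\<close> modulo \<open>p\<close>.
\<close>

lemma square_cong_imp_QuadRes:
  fixes p u z :: nat
  assumes p: "prime p" and "2 * \<alpha> + 1 \<le> r" and c: "[z\<^sup>2 = p ^ (2 * \<alpha>) * u] (mod p ^ r)"
  shows "QuadRes (int p) (int u)"
proof -
  from c have c': "[z\<^sup>2 = p ^ (2 * \<alpha>) * u] (mod p ^ (2 * \<alpha>) * p)"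
    by (rule cong_dvd_modulus_nat)
       (use le_imp_power_dvd[OF \<open>2 * \<alpha> + 1 \<le> r\<close>, of p] in \<open>simp add: mult.commute\<close>)
  then have "[z\<^sup>2 = p ^ (2 * \<alpha>) * u] (mod p ^ (2 * \<alpha>))" by (rule cong_modulus_mult_nat)
  then have "(p ^ \<alpha>)\<^sup>2 dvd z\<^sup>2" by (simp add: cong_dvd_iff mult.commute flip: power_mult)
  then obtain w where "z = p ^ \<alpha> * w" by auto
  then have "z\<^sup>2 = p ^ (2 * \<alpha>) * w\<^sup>2" by (simp add: power_mult_distrib mult.commute flip: power_mult)
  with c' have "[p ^ (2 * \<alpha>) * w\<^sup>2 = p ^ (2 * \<alpha>) * u] (mod p ^ (2 * \<alpha>) * p)" by simp
  then have "[w\<^sup>2 = u] (mod p)"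
    using p by (simp add: cong_def prime_gt_0_nat flip: mult_mod_right)
  then have "[int w ^ 2 = int u] (mod int p)" by (metis cong_int_iff of_nat_power)
  then show ?thesis by (auto simp: QuadRes_def)
qed

theorem theorem3p3:
  fixes p r k :: nat
  assumes "prime p" and "p \<ge> 5" and "r \<ge> 1" and "k = p ^ r"
  shows "(\<forall>n i \<alpha>. i \<in> {1..p - 1} \<and> 1 \<le> \<alpha> \<and> real \<alpha> \<le> real r / 2 \<longrightarrow>
            [bracelet k (p ^ (2 * \<alpha>) * n + ((12 * i + p) * p ^ (2 * \<alpha> - 1) - 1) div 12) = 0]
              (mod int p)) \<and>
         (\<forall>j \<in> {1..p - 1}. \<not> QuadRes (int p) (12 * int j + 1) \<longrightarrow>
            (\<forall>n \<alpha>. 1 \<le> \<alpha> \<and> real \<alpha> \<le> (real r - 1) / 2 \<longrightarrow>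
              [bracelet k (p ^ (2 * \<alpha> + 1) * n + ((12 * j + 1) * p ^ (2 * \<alpha>) - 1) div 12) = 0]
                (mod int p)))"
proof (intro conjI allI ballI impI; (elim conjE)?)
  have odd: "odd p" using assms(1,2) prime_odd_nat[of p] by simp
  {
    fix n i \<alpha> :: nat
    assume i: "i \<in> {1..p - 1}" and \<alpha>: "1 \<le> \<alpha>" "real \<alpha> \<le> real r / 2"
    define N where "N = p ^ (2 * \<alpha>) * n + ((12 * i + p) * p ^ (2 * \<alpha> - 1) - 1) div 12"
    have pos: "(12 * i + p) * p ^ (2 * \<alpha> - 1) \<ge> 1"
      using assms(2) by (simp add: Suc_leI)
    have "12 * (((12 * i + p) * p ^ (2 * \<alpha> - 1) - 1) div 12) = (12 * i + p) * p ^ (2 * \<alpha> - 1) - 1"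
      using twelve_dvd_arguments(1)[OF assms(1,2) \<alpha>(1), of i] by (rule dvd_mult_div_cancel)
    then have "12 * N + 1 = 12 * (p ^ (2 * \<alpha>) * n) + (12 * i + p) * p ^ (2 * \<alpha> - 1)"
      using pos by (simp only: N_def distrib_left add.assoc le_add_diff_inverse2)
    also have "p ^ (2 * \<alpha>) = p ^ (2 * \<alpha> - 1) * p" 
      using \<alpha>(1) by (simp flip: power_Suc2)
    finally have N: "12 * N + 1 = p ^ (2 * \<alpha> - 1) * (12 * i + p * (12 * n + 1))"
      by (simp add: algebra_simps)
    have "\<not> p dvd 12"
    proof
      assume "p dvd 12"
      then have "p dvd 2 * 2 * 3" by simp
      then have "p dvd 2 \<or> p dvd 3" using assms(1) by (auto simp only: prime_dvd_mult_iff)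
      then show False using assms(2) by (auto dest: dvd_imp_le)
    qed
    moreover have "\<not> p dvd i" using i by (auto dest: dvd_imp_le)
    ultimately have "\<not> p dvd 12 * i + p * (12 * n + 1)"
      using assms(1) by (simp only: dvd_add_left_iff[OF dvd_triv_left] prime_dvd_mult_iff) simp
    moreover have "2 * \<alpha> \<le> r" using \<alpha>(2) by linarith
    ultimately show "[bracelet k N = 0] (mod int p)"
      using \<alpha>(1) assms(1) unfolding \<open>k = p ^ r\<close>
      by (intro bracelet_prime_power_dvd[OF assms(1) odd refl])
         (simp only: N square_not_cong_odd_valuation not_False_eq_True)
  next
    fix j n \<alpha> :: nat
    assume j: "\<not> QuadRes (int p) (12 * int j + 1)" and \<alpha>: "1 \<le> \<alpha>" "real \<alpha> \<le> (real r - 1) / 2"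
    define N where "N = p ^ (2 * \<alpha> + 1) * n + ((12 * j + 1) * p ^ (2 * \<alpha>) - 1) div 12"
    have pos: "(12 * j + 1) * p ^ (2 * \<alpha>) \<ge> 1"
      using assms(2) by (simp add: Suc_leI)
    have "12 * (((12 * j + 1) * p ^ (2 * \<alpha>) - 1) div 12) = (12 * j + 1) * p ^ (2 * \<alpha>) - 1"
      using twelve_dvd_arguments(2)[OF assms(1,2) \<alpha>(1), of j] by (rule dvd_mult_div_cancel)
    then have "12 * N + 1 = 12 * (p ^ (2 * \<alpha> + 1) * n) + (12 * j + 1) * p ^ (2 * \<alpha>)"
      using pos by (simp only: N_def distrib_left add.assoc le_add_diff_inverse2)
    then have N: "12 * N + 1 = p ^ (2 * \<alpha>) * (12 * j + 1 + p * (12 * n))"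
      by (simp add: algebra_simps)
    have "[12 * int j + 1 = int (12 * j + 1 + p * (12 * n))] (mod int p)"
      by (simp add: cong_iff_dvd_diff)
    then have nQ: "\<not> QuadRes (int p) (int (12 * j + 1 + p * (12 * n)))"
      using j unfolding QuadRes_def by (meson cong_sym cong_trans)
    have "real (2 * \<alpha> + 1) \<le> real r" using \<alpha>(2) by simp
    then have r: "2 * \<alpha> + 1 \<le> r" by (simp only: of_nat_le_iff)
    show "[bracelet k N = 0] (mod int p)"
      unfolding \<open>k = p ^ r\<close>
    proof (rule bracelet_prime_power_dvd[OF assms(1) odd refl])
      show "\<not> [z\<^sup>2 = 12 * N + 1] (mod p ^ r)" for z
        unfolding N using square_cong_imp_QuadRes[OF assms(1) r] nQ by blast
    qed
  }
qed

end
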